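(* Let $X$ be a real Hilbert space, $n\ge2$, let $A_1,\dots,A_n$ be maximally monotone operators on $X$ and $B_1,\dots,B_{n-1}$ be $\beta$-cocoercive operators on $X$ ($\beta>0$). Let $G=(\mathcal{N},\mathcal{E})$ be a directed graph on $\mathcal{N}=\{1,\dots,n\}$ that is connected, simple and such that $(i,j)\in\mathcal{E}$ implies $i<j$, with $h$, $\kappa_i$, $\kappa_i^+$ as in the context. Consider the following directed trees $G'$ on $\mathcal{N}$ (with arcs enumerated as indicated) and operators $Q'_{\delta\gets\gamma}:X^{n-1}\to X^{n-1}$, $\delta,\gamma>0$, where $\mathbf{x}_1^\gamma$ is the map defined in the context from $G'$: (i) Inward star: arcs $e_i=(i,n)$, $i=1,\dots,n-1$, and for $i=1,\dots,n-1$, $(\check Q_{\delta\gets\gamma}\mathbf{z})_i:=\frac\delta\gamma\mathbf{z}_i+\big(1-\frac\delta\gamma\big)(\kappa_i-2\kappa_i^+)\,\mathbf{x}^\gamma_1(\mathbf{z})$. (ii) Outward star: arcs $e_i=(1,i+1)$, $i=1,\dots,n-1$, and for $i=1,\dots,n-1$, $(\hat Q_{\delta\gets\gamma}\mathbf{z})_i:=\frac\delta\gamma\mathbf{z}_i-\big(1-\frac\delta\gamma\big)(\kappa_{i+1}-2\kappa_{i+1}^+)\,\mathbf{x}^\gamma_1(\mathbf{z})$. (iii) Sequential: arcs $e_i=(i,i+1)$, $i=1,\dots,n-1$, and for $i=1,\dots,n-1$, $(\bar Q_{\delta\gets\gamma}\mathbf{z})_i:=\frac\delta\gamma\mathbf{z}_i+\big(1-\frac\delta\gamma\big)\big(\sum_{j=1}^i(\kappa_j-2\kappa_j^+)\big)\mathbf{x}^\gamma_1(\mathbf{z})$.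 In each of the three cases, if $G'$ is a subgraph of $G$, then for every $\theta>0$ the corresponding operators $(Q'_{\delta\gets\gamma})_{\delta,\gamma>0}$ define fixed-point relocators (for some Lipschitz constants in $[1,+\infty)$) for the operators $(T_{\theta,\gamma})_{\gamma>0}$ defined by the incidence matrix of $G'$, and for all $\delta,\gamma>0$ and $\mathbf{z}\in X^{n-1}$, $$\mathbf{x}_1^\gamma(\mathbf{z})=\mathbf{x}_1^\delta(Q'_{\delta\gets\gamma}\mathbf{z}).$$
   Context: $X^n$ carries the $\ell_2$ product norm; $J_A=(\mathrm{Id}+A)^{-1}$; $\operatorname{Fix}T=\{x:Tx=x\}$. $B$ is $\beta$-cocoercive (paper's convention) if $\langle Bx-By,x-y\rangle\ge\frac1\beta\|Bx-By\|^2$ for all $x,y$. Connectedness ignores orientation; simple means no multiple arcs between two nodes. $\kappa_i$ and $\kappa_i^+=|\{j:(j,i)\in\mathcal{E}\}|$ are the degree and in-degree of node $i$ in $G$. $h:\{2,\dots,n\}\to\{1,\dots,n-1\}$ is a function with $(h(i),i)\in\mathcal{E}$ for all $i$. For a connected subgraph $G'=(\mathcal{N},\mathcal{E}')$ of $G$ with arcs $e_1,\dots,e_{n-1}$, $\mathrm{Inc}(G')\in\mathbb{R}^{n\times(n-1)}$ has $(i,j)$ entry $1$ if arc $e_j$ leaves node $i$, $-1$ if $e_j$ enters node $i$, $0$ otherwise. For $\gamma>0$, $\mathbf{x}^\gamma:X^{n-1}\to X^n$ is defined by $\mathbf{x}_1^\gamma(\mathbf{z})=J_{\frac\gamma{\kappa_1}A_1}\big(\frac1{\kappa_1}\sum_{j=1}^{n-1}\mathrm{Inc}(G')_{1j}\mathbf{z}_j\big)$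 and, for $i=2,\dots,n$, $$\mathbf{x}_i^\gamma(\mathbf{z})=J_{\frac\gamma{\kappa_i}A_i}\Big(\tfrac2{\kappa_i}\sum_{j:(j,i)\in\mathcal{E}}\mathbf{x}^\gamma_j(\mathbf{z})-\tfrac\gamma{\kappa_i}B_{i-1}\mathbf{x}^\gamma_{h(i)}(\mathbf{z})+\tfrac1{\kappa_i}\sum_{j=1}^{n-1}\mathrm{Inc}(G')_{ij}\mathbf{z}_j\Big).$$ For $\theta,\gamma>0$, $T_{\theta,\gamma}:X^{n-1}\to X^{n-1}$ is $(T_{\theta,\gamma}\mathbf{z})_i=\mathbf{z}_i-\theta\sum_{j=1}^n\mathrm{Inc}(G')_{ji}\mathbf{x}^\gamma_j(\mathbf{z})$. Fixed-point relocators: operators $(Q_{\delta\gets\gamma})_{\gamma,\delta\in\Gamma}$ on a Hilbert space $Y$ define fixed-point relocators for operators $(T_\gamma)_{\gamma\in\Gamma}$ on $Y$ with Lipschitz constants $(\mathcal{L}_{\delta\gets\gamma})$ in $[1,+\infty)$ if: (a) for all $\gamma,\delta$, $Q_{\delta\gets\gamma}|_{\operatorname{Fix}T_\gamma}$ is a bijection from $\operatorname{Fix}T_\gamma$ to $\operatorname{Fix}T_\delta$; (b) for all $\gamma$ and $x\in\operatorname{Fix}T_\gamma$, $\delta\mapsto Q_{\delta\gets\gamma}x$ is continuous; (c) for all $\gamma,\delta,\varepsilon$ and $x\in\operatorname{Fix}T_\gamma$, $Q_{\varepsilon\gets\delta}Q_{\delta\gets\gamma}x=Q_{\varepsilon\gets\gamma}x$;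 (d) each $Q_{\delta\gets\gamma}$ is $\mathcal{L}_{\delta\gets\gamma}$-Lipschitz continuous. *)

theory Defs
  imports "HOL-Analysis.Analysis" "Graph_Theory.Digraph_Component"
begin

section \<open>Monotone operators\<close>

text \<open>A set-valued operator on \<open>X\<close> is a function \<open>X \<Rightarrow> X set\<close>; the order \<open>\<le>\<close> on such functions is
  inclusion of graphs.\<close>

definition monotone_op :: "('a::real_inner \<Rightarrow> 'a set) \<Rightarrow> bool" where
  "monotone_op A \<longleftrightarrow> (\<forall>x y. \<forall>u\<in>A x. \<forall>v\<in>A y. (u - v) \<bullet> (x - y) \<ge> 0)"

definition maximally_monotone :: "('a::real_inner \<Rightarrow> 'a set) \<Rightarrow> bool" where
  "maximally_monotone A \<longleftrightarrow>
     monotone_op A \<and> (\<forall>A'. monotone_op A' \<longrightarrow> A \<le> A' \<longrightarrow> A' = A)"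

definition scale_op :: "real \<Rightarrow> ('a::real_vector \<Rightarrow> 'a set) \<Rightarrow> 'a \<Rightarrow> 'a set" where
  "scale_op c A x = (\<lambda>u. c *\<^sub>R u) ` A x"

definition Id_plus :: "('a::ab_group_add \<Rightarrow> 'a set) \<Rightarrow> 'a \<Rightarrow> 'a set" where
  "Id_plus A x = (\<lambda>u. x + u) ` A x"

definition inverse_op :: "('a \<Rightarrow> 'b set) \<Rightarrow> 'b \<Rightarrow> 'a set" where
  "inverse_op A y = {x. y \<in> A x}"

text \<open>The set-valued map \<open>(Id + A)\<^sup>-\<^sup>1\<close> is identified with the function giving its unique value, so
  \<open>resolvent A y\<close> is meaningful only where that value set is a singleton (everywhere, when \<open>A\<close> is
  maximally monotone, by Minty's theorem).\<close>

definition resolvent :: "('a::ab_group_add \<Rightarrow> 'a set) \<Rightarrow> 'a \<Rightarrow> 'a" where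
  "resolvent A y = the_elem (inverse_op (Id_plus A) y)"

text \<open>Convention: the cocoercivity constant enters as \<open>1/\<beta>\<close>.\<close>

definition cocoercive :: "real \<Rightarrow> ('a::real_inner \<Rightarrow> 'a) \<Rightarrow> bool" where
  "cocoercive \<beta> B \<longleftrightarrow> (\<forall>x y. (B x - B y) \<bullet> (x - y) \<ge> 1 / \<beta> * (norm (B x - B y))\<^sup>2)"


section \<open>The product spaces\<close>

text \<open>\<open>X\<^sup>m\<close> consists of the families indexed by \<open>1,\<dots>,m\<close>, extended by \<open>undefined\<close> outside \<open>{1..m}\<close>;
  it carries the distance of the \<open>\<ell>\<^sub>2\<close> product norm.\<close>

definition tuples :: "nat \<Rightarrow> (nat \<Rightarrow> 'a) set" where
  "tuples m = {1..m} \<rightarrow>\<^sub>E UNIV"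

definition l2_dist :: "nat \<Rightarrow> (nat \<Rightarrow> 'a::real_normed_vector) \<Rightarrow> (nat \<Rightarrow> 'a) \<Rightarrow> real" where
  "l2_dist m z w = L2_set (\<lambda>i. norm (z i - w i)) {1..m}"

lemma Metric_space_l2: "Metric_space (tuples m) (l2_dist m)"
proof
  fix x y z :: "nat \<Rightarrow> 'a"
  show "0 \<le> l2_dist m x y" by (simp add: l2_dist_def)
  show "l2_dist m x y = l2_dist m y x" by (simp add: l2_dist_def norm_minus_commute)
  show "(l2_dist m x y = 0) = (x = y)" if "x \<in> tuples m" "y \<in> tuples m"
    using that by (auto simp: l2_dist_def tuples_def L2_set_eq_0_iff intro: PiE_ext)
  have "l2_dist m x z \<le> L2_set (\<lambda>i. norm (x i - y i) + norm (y i - z i)) {1..m}"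
    unfolding l2_dist_def
    by (intro L2_set_mono) (auto intro: norm_diff_triangle_le)
  also have "\<dots> \<le> l2_dist m x y + l2_dist m y z"
    unfolding l2_dist_def by (rule L2_set_triangle_ineq)
  finally show "l2_dist m x z \<le> l2_dist m x y + l2_dist m y z" .
qed


section \<open>Fixed-point relocators\<close>

definition Fix :: "'y set \<Rightarrow> ('y \<Rightarrow> 'y) \<Rightarrow> 'y set" where
  "Fix Y T = {x \<in> Y. T x = x}"

text \<open>The space is given by its carrier \<open>Y\<close> and its distance \<open>d\<close>. \<open>Q \<delta> \<gamma>\<close> stands for
  \<open>Q\<^bsub>\<delta>\<leftarrow>\<gamma>\<^esub>\<close>, and likewise \<open>L \<delta> \<gamma>\<close> for its Lipschitz constant.\<close>

definition fixed_point_relocators ::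
  "'y set \<Rightarrow> ('y \<Rightarrow> 'y \<Rightarrow> real) \<Rightarrow> real set \<Rightarrow> (real \<Rightarrow> 'y \<Rightarrow> 'y)
    \<Rightarrow> (real \<Rightarrow> real \<Rightarrow> 'y \<Rightarrow> 'y) \<Rightarrow> (real \<Rightarrow> real \<Rightarrow> real) \<Rightarrow> bool" where
  "fixed_point_relocators Y d \<Gamma> T Q L \<longleftrightarrow>
     (\<forall>\<gamma>\<in>\<Gamma>. T \<gamma> \<in> Y \<rightarrow> Y) \<and>
     (\<forall>\<gamma>\<in>\<Gamma>. \<forall>\<delta>\<in>\<Gamma>. Q \<delta> \<gamma> \<in> Y \<rightarrow> Y) \<and>
     (\<forall>\<gamma>\<in>\<Gamma>. \<forall>\<delta>\<in>\<Gamma>. 1 \<le> L \<delta> \<gamma>) \<and>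
     (\<forall>\<gamma>\<in>\<Gamma>. \<forall>\<delta>\<in>\<Gamma>. bij_betw (Q \<delta> \<gamma>) (Fix Y (T \<gamma>)) (Fix Y (T \<delta>))) \<and>
     (\<forall>\<gamma>\<in>\<Gamma>. \<forall>x\<in>Fix Y (T \<gamma>).
        continuous_map (top_of_set \<Gamma>) (Metric_space.mtopology Y d) (\<lambda>\<delta>. Q \<delta> \<gamma> x)) \<and>
     (\<forall>\<gamma>\<in>\<Gamma>. \<forall>\<delta>\<in>\<Gamma>. \<forall>\<epsilon>\<in>\<Gamma>. \<forall>x\<in>Fix Y (T \<gamma>). Q \<epsilon> \<delta> (Q \<delta> \<gamma> x) = Q \<epsilon> \<gamma> x) \<and>
     (\<forall>\<gamma>\<in>\<Gamma>. \<forall>\<delta>\<in>\<Gamma>. \<forall>x\<in>Y. \<forall>y\<in>Y. d (Q \<delta> \<gamma> x) (Q \<delta> \<gamma> y) \<le> L \<delta> \<gamma> * d x y)"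


section \<open>The algorithm operators of a graph\<close>

text \<open>Arcs are pairs (tail, head). A subgraph \<open>G'\<close> with \<open>n - 1\<close> arcs is given by
  an enumeration \<open>e\<close> of its arcs by \<open>1,\<dots>,n-1\<close>.\<close>

definition spanning_graph :: "nat \<Rightarrow> (nat \<Rightarrow> nat \<times> nat) \<Rightarrow> nat pair_pre_digraph" where
  "spanning_graph n e = \<lparr> pverts = {1..n}, parcs = e ` {1..n-1} \<rparr>"

definition Inc :: "(nat \<Rightarrow> nat \<times> nat) \<Rightarrow> nat \<Rightarrow> nat \<Rightarrow> real" where
  "Inc e i j = (if fst (e j) = i then 1 else if snd (e j) = i then - 1 else 0)"

definition node_degree :: "nat pair_pre_digraph \<Rightarrow> nat \<Rightarrow> nat" where
  "node_degree G i = in_degree (with_proj G) i + out_degree (with_proj G) i"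

text \<open>\<open>degree_gap G i\<close> is \<open>\<kappa>\<^sub>i - 2\<kappa>\<^sub>i\<^sup>+\<close>, with \<open>\<kappa>\<^sub>i\<^sup>+\<close> the in-degree.\<close>

definition degree_gap :: "nat pair_pre_digraph \<Rightarrow> nat \<Rightarrow> real" where
  "degree_gap G i = real (node_degree G i) - 2 * real (in_degree (with_proj G) i)"

text \<open>\<open>x_step\<close> is the right-hand side of the equation defining the \<open>i\<close>-th component of
  \<open>\<^bold>x\<^sup>\<gamma>(\<^bold>z)\<close> in terms of components \<open>x j\<close>, \<open>j < i\<close>. The components are computed in the order
  \<open>1,\<dots>,n\<close>; lemmas \<open>x_map_1\<close> and \<open>x_map_step\<close> below recover the defining equations.\<close>

definition x_step :: "nat \<Rightarrow> nat pair_pre_digraph \<Rightarrow> (nat \<Rightarrow> nat \<times> nat) \<Rightarrow> (nat \<Rightarrow> nat)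
    \<Rightarrow> (nat \<Rightarrow> 'a::real_inner \<Rightarrow> 'a set) \<Rightarrow> (nat \<Rightarrow> 'a \<Rightarrow> 'a) \<Rightarrow> real \<Rightarrow> (nat \<Rightarrow> 'a)
    \<Rightarrow> nat \<Rightarrow> (nat \<Rightarrow> 'a) \<Rightarrow> 'a" where
  "x_step n G e h A B \<gamma> z i x =
     (if i = 1 then
        resolvent (scale_op (\<gamma> / node_degree G 1) (A 1))
          ((1 / node_degree G 1) *\<^sub>R (\<Sum>j=1..n-1. Inc e 1 j *\<^sub>R z j))
      else
        resolvent (scale_op (\<gamma> / node_degree G i) (A i))
          ((2 / node_degree G i) *\<^sub>R (\<Sum>j\<in>{j. (j, i) \<in> parcs G}. x j)
           - (\<gamma> / node_degree G i) *\<^sub>R B (i - 1) (x (h i))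
           + (1 / node_degree G i) *\<^sub>R (\<Sum>j=1..n-1. Inc e i j *\<^sub>R z j)))"

primrec x_upto :: "nat \<Rightarrow> nat pair_pre_digraph \<Rightarrow> (nat \<Rightarrow> nat \<times> nat) \<Rightarrow> (nat \<Rightarrow> nat)
    \<Rightarrow> (nat \<Rightarrow> 'a::real_inner \<Rightarrow> 'a set) \<Rightarrow> (nat \<Rightarrow> 'a \<Rightarrow> 'a) \<Rightarrow> real \<Rightarrow> (nat \<Rightarrow> 'a)
    \<Rightarrow> nat \<Rightarrow> (nat \<Rightarrow> 'a)" where
  "x_upto n G e h A B \<gamma> z 0 = (\<lambda>_. undefined)"
| "x_upto n G e h A B \<gamma> z (Suc k) =
     (x_upto n G e h A B \<gamma> z k)
       (Suc k := x_step n G e h A B \<gamma> z (Suc k) (x_upto n G e h A B \<gamma> z k))"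

definition x_map :: "nat \<Rightarrow> nat pair_pre_digraph \<Rightarrow> (nat \<Rightarrow> nat \<times> nat) \<Rightarrow> (nat \<Rightarrow> nat)
    \<Rightarrow> (nat \<Rightarrow> 'a::real_inner \<Rightarrow> 'a set) \<Rightarrow> (nat \<Rightarrow> 'a \<Rightarrow> 'a) \<Rightarrow> real \<Rightarrow> (nat \<Rightarrow> 'a)
    \<Rightarrow> (nat \<Rightarrow> 'a)" where
  "x_map n G e h A B \<gamma> z = x_upto n G e h A B \<gamma> z n"

lemma x_upto_stable:
  assumes "i \<le> k" "k \<le> m"
  shows "x_upto n G e h A B \<gamma> z m i = x_upto n G e h A B \<gamma> z k i"
  using assms(2,1) by (induction m rule: dec_induct) auto

lemma x_map_in_tuples: "x_map n G e h A B \<gamma> z \<in> tuples n"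
proof -
  have "x_upto n G e h A B \<gamma> z k \<in> tuples k" for k
    by (induction k) (auto simp: tuples_def PiE_iff extensional_def)
  then show ?thesis by (simp add: x_map_def)
qed

lemma x_map_1:
  assumes "1 \<le> n"
  shows "x_map n G e h A B \<gamma> z 1 =
    resolvent (scale_op (\<gamma> / node_degree G 1) (A 1))
      ((1 / node_degree G 1) *\<^sub>R (\<Sum>j=1..n-1. Inc e 1 j *\<^sub>R z j))"
  unfolding x_map_def using x_upto_stable[of 1 1 n] assms by (simp add: x_step_def)

lemma x_map_step:
  assumes "i \<in> {2..n}" "(h i, i) \<in> parcs G" "\<And>j. (j, i) \<in> parcs G \<Longrightarrow> j < i"
  shows "x_map n G e h A B \<gamma> z i =
    resolvent (scale_op (\<gamma> / node_degree G i) (A i))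
      ((2 / node_degree G i) *\<^sub>R (\<Sum>j\<in>{j. (j, i) \<in> parcs G}. x_map n G e h A B \<gamma> z j)
       - (\<gamma> / node_degree G i) *\<^sub>R B (i - 1) (x_map n G e h A B \<gamma> z (h i))
       + (1 / node_degree G i) *\<^sub>R (\<Sum>j=1..n-1. Inc e i j *\<^sub>R z j))"
proof -
  obtain k where k: "i = Suc k" using assms(1) by (cases i) auto
  have *: "x_upto n G e h A B \<gamma> z k j = x_map n G e h A B \<gamma> z j" if "(j, i) \<in> parcs G" for j
    unfolding x_map_def using assms(1) assms(3)[OF that] k
    by (intro x_upto_stable[symmetric]) auto
  have "x_map n G e h A B \<gamma> z i = x_upto n G e h A B \<gamma> z (Suc k) i"
    unfolding x_map_def using assms(1) k by (intro x_upto_stable) auto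
  also have "\<dots> = x_step n G e h A B \<gamma> z i (x_upto n G e h A B \<gamma> z k)"
    by (simp add: k)
  also have "\<dots> = x_step n G e h A B \<gamma> z i (x_map n G e h A B \<gamma> z)"
  proof -
    have "(\<Sum>j\<in>{j. (j, i) \<in> parcs G}. x_upto n G e h A B \<gamma> z k j)
        = (\<Sum>j\<in>{j. (j, i) \<in> parcs G}. x_map n G e h A B \<gamma> z j)"
      by (intro sum.cong) (auto simp: *)
    then show ?thesis by (simp only: x_step_def *[OF assms(2)])
  qed
  finally show ?thesis using assms(1) by (simp add: x_step_def)
qed

definition T_op :: "nat \<Rightarrow> nat pair_pre_digraph \<Rightarrow> (nat \<Rightarrow> nat \<times> nat) \<Rightarrow> (nat \<Rightarrow> nat)
    \<Rightarrow> (nat \<Rightarrow> 'a::real_inner \<Rightarrow> 'a set) \<Rightarrow> (nat \<Rightarrow> 'a \<Rightarrow> 'a) \<Rightarrow> real \<Rightarrow> real \<Rightarrow> (nat \<Rightarrow> 'a)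
    \<Rightarrow> (nat \<Rightarrow> 'a)" where
  "T_op n G e h A B \<theta> \<gamma> z =
     (\<lambda>i\<in>{1..n-1}. z i - \<theta> *\<^sub>R (\<Sum>j=1..n. Inc e j i *\<^sub>R x_map n G e h A B \<gamma> z j))"


section \<open>The three trees and their relocators\<close>

definition inward_star :: "nat \<Rightarrow> nat \<Rightarrow> nat \<times> nat" where
  "inward_star n i = (i, n)"

definition outward_star :: "nat \<Rightarrow> nat \<times> nat" where
  "outward_star i = (1, i + 1)"

definition sequential_path :: "nat \<Rightarrow> nat \<times> nat" where
  "sequential_path i = (i, i + 1)"

definition Q_inward :: "nat \<Rightarrow> nat pair_pre_digraph \<Rightarrow> (nat \<Rightarrow> nat)
    \<Rightarrow> (nat \<Rightarrow> 'a::real_inner \<Rightarrow> 'a set) \<Rightarrow> (nat \<Rightarrow> 'a \<Rightarrow> 'a) \<Rightarrow> real \<Rightarrow> real \<Rightarrow> (nat \<Rightarrow> 'a)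
    \<Rightarrow> (nat \<Rightarrow> 'a)" where
  "Q_inward n G h A B \<delta> \<gamma> z =
     (\<lambda>i\<in>{1..n-1}. (\<delta> / \<gamma>) *\<^sub>R z i
        + ((1 - \<delta> / \<gamma>) * degree_gap G i) *\<^sub>R x_map n G (inward_star n) h A B \<gamma> z 1)"

definition Q_outward :: "nat \<Rightarrow> nat pair_pre_digraph \<Rightarrow> (nat \<Rightarrow> nat)
    \<Rightarrow> (nat \<Rightarrow> 'a::real_inner \<Rightarrow> 'a set) \<Rightarrow> (nat \<Rightarrow> 'a \<Rightarrow> 'a) \<Rightarrow> real \<Rightarrow> real \<Rightarrow> (nat \<Rightarrow> 'a)
    \<Rightarrow> (nat \<Rightarrow> 'a)" where
  "Q_outward n G h A B \<delta> \<gamma> z =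
     (\<lambda>i\<in>{1..n-1}. (\<delta> / \<gamma>) *\<^sub>R z i
        - ((1 - \<delta> / \<gamma>) * degree_gap G (i + 1)) *\<^sub>R x_map n G outward_star h A B \<gamma> z 1)"

definition Q_sequential :: "nat \<Rightarrow> nat pair_pre_digraph \<Rightarrow> (nat \<Rightarrow> nat)
    \<Rightarrow> (nat \<Rightarrow> 'a::real_inner \<Rightarrow> 'a set) \<Rightarrow> (nat \<Rightarrow> 'a \<Rightarrow> 'a) \<Rightarrow> real \<Rightarrow> real \<Rightarrow> (nat \<Rightarrow> 'a)
    \<Rightarrow> (nat \<Rightarrow> 'a)" where
  "Q_sequential n G h A B \<delta> \<gamma> z =
     (\<lambda>i\<in>{1..n-1}. (\<delta> / \<gamma>) *\<^sub>R z i
        + ((1 - \<delta> / \<gamma>) * (\<Sum>j=1..i. degree_gap G j)) *\<^sub>R x_map n G sequential_path h A B \<gamma> z 1)"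

end

theory Submission
  imports Defs
begin

text \<open>If \<open>x = J\<^bsub>cA\<^esub> y\<close> then \<open>x = J\<^bsub>tcA\<^esub> (t y + (1 - t) x)\<close>; take \<open>t = \<delta>/\<gamma>\<close>. If all components of
  \<open>x\<^sup>\<gamma>(z)\<close> equal \<open>x\<close>, then node \<open>i\<close> receives \<open>2\<kappa>\<^sub>i\<^sup>+ x - \<gamma> B x\<close> from its predecessors, so for the input of
  its resolvent to be moved in this way the tree has to contribute \<open>(1 - t)(\<kappa>\<^sub>i - 2\<kappa>\<^sub>i\<^sup>+) x\<close> besides
  \<open>t (Inc(G') z)\<^sub>i\<close>, which is what \<open>Q\<close> does. Hence all components of \<open>x\<^sup>\<delta>(Q z)\<close> equal \<open>x\<close> as well. Fixed
  points of \<open>T\<close> are the \<open>z\<close> with equal components of \<open>x\<^sup>\<gamma>(z)\<close>; for node 1, which has no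
  predecessors, the argument applies to every \<open>z\<close>.\<close>

section \<open>Minty's theorem\<close>

text \<open>Inserting \<open>(x, u)\<close> into the graph of \<open>A\<close> keeps it monotone, so
  by maximality the pair was there already.\<close>

lemma maximally_monotone_mem:
  assumes "maximally_monotone A" "\<And>y v. v \<in> A y \<Longrightarrow> (u - v) \<bullet> (x - y) \<ge> 0"
  shows "u \<in> A x"
proof -
  let ?A' = "A(x := insert u (A x))"
  have mono: "monotone_op A"
    using assms(1) by (simp add: maximally_monotone_def)
  have sym: "(v - u) \<bullet> (y - x) \<ge> 0" if "v \<in> A y" for y v
    using assms(2)[OF that] by (simp add: inner_diff_left inner_diff_right)
  have "monotone_op ?A'"
    unfolding monotone_op_def
  proof (intro allI ballI)
    fix y z v w assume "v \<in> ?A' y" "w \<in> ?A' z"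
    then consider "v \<in> A y" "w \<in> A z" | "v \<in> A y" "z = x" "w = u"
      | "y = x" "v = u" "w \<in> A z" | "y = x" "v = u" "z = x" "w = u"
      by (auto split: if_splits)
    then show "(v - w) \<bullet> (y - z) \<ge> 0"
      by cases (use mono assms(2) sym in \<open>auto simp: monotone_op_def\<close>)
  qed
  moreover have "A \<le> ?A'"
    by (auto simp: le_fun_def)
  ultimately have "?A' = A"
    using assms(1) by (simp add: maximally_monotone_def)
  then show ?thesis
    by (metis fun_upd_same insertI1)
qed

text \<open>The function to be minimized is the supremum of \<open>f i\<close> over
  \<open>I\<close>; upper bounds \<open>r\<close> stand in for it because it may be infinite at some
  points. Near-minimizers form a Cauchy sequence, since otherwise their midpoints would fall below
  the infimum. The limit inherits the bound from the continuity of each \<open>f i\<close>.\<close>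

lemma strongly_midpoint_convex_minimizer:
  fixes f :: "'i \<Rightarrow> 'b::{real_normed_vector, complete_space} \<Rightarrow> real"
  assumes midpoint: "\<And>i x y. i \<in> I \<Longrightarrow>
      f i ((1/2) *\<^sub>R (x + y)) \<le> (f i x + f i y) / 2 - c * (norm (x - y))\<^sup>2"
    and "c > 0"
    and cont: "\<And>i. i \<in> I \<Longrightarrow> continuous_on UNIV (f i)"
    and low: "\<And>x r. (\<forall>i\<in>I. f i x \<le> r) \<Longrightarrow> b \<le> r"
    and fin: "\<forall>i\<in>I. f i x0 \<le> r0"
  obtains x m where "\<forall>i\<in>I. f i x \<le> m" "\<And>y r. (\<forall>i\<in>I. f i y \<le> r) \<Longrightarrow> m \<le> r"
proof -
  define R where "R = {r. \<exists>x. \<forall>i\<in>I. f i x \<le> r}"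
  define m where "m = Inf R"
  have bdd: "bdd_below R"
    using low by (auto simp: R_def intro!: bdd_belowI)
  have ne: "R \<noteq> {}"
    using fin by (auto simp: R_def)
  have m_le: "m \<le> r" if "\<forall>i\<in>I. f i y \<le> r" for y r
    unfolding m_def using that by (intro cInf_lower bdd) (auto simp: R_def)
  have "\<exists>x. \<forall>i\<in>I. f i x \<le> m + 1 / Suc k" for k
  proof -
    obtain r where "r \<in> R" "r < m + 1 / Suc k"
      unfolding m_def using cInf_lessD[OF ne, of "Inf R + 1 / Suc k"] by auto
    then show ?thesis
      unfolding R_def by (smt (verit) mem_Collect_eq)
  qed
  then obtain X where X: "\<And>k i. i \<in> I \<Longrightarrow> f i (X k) \<le> m + 1 / Suc k"
    by metis
  \<comment> \<open>At the midpoint the convexity gain cannot exceed the mean excess of the two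
    points over \<open>m\<close>.\<close>
  have dist: "c * (norm (X k - X l))\<^sup>2 \<le> (1 / Suc k + 1 / Suc l) / 2" for k l
  proof -
    have "\<forall>i\<in>I. f i ((1/2) *\<^sub>R (X k + X l))
        \<le> m + (1 / Suc k + 1 / Suc l) / 2 - c * (norm (X k - X l))\<^sup>2"
    proof
      fix i assume i: "i \<in> I"
      show "f i ((1/2) *\<^sub>R (X k + X l))
        \<le> m + (1 / Suc k + 1 / Suc l) / 2 - c * (norm (X k - X l))\<^sup>2"
        using midpoint[OF i, of "X k" "X l"] X[OF i, of k] X[OF i, of l] by argo
    qed
    from m_le[OF this] show ?thesis by simp
  qed
  have "Cauchy X"
  proof (rule metric_CauchyI)
    fix e :: real assume "e > 0"
    then obtain N where N: "1 / Suc N < c * e\<^sup>2"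
      using \<open>c > 0\<close> by (metis nat_approx_posE zero_less_power mult_pos_pos)
    have "dist (X k) (X l) < e" if "k \<ge> N" "l \<ge> N" for k l
    proof -
      have "1 / Suc k \<le> 1 / Suc N" "1 / Suc l \<le> 1 / Suc N"
        using that by (auto simp: frac_le)
      then have "c * (norm (X k - X l))\<^sup>2 < c * e\<^sup>2"
        using dist[of k l] N by argo
      then have "(norm (X k - X l))\<^sup>2 < e\<^sup>2"
        using \<open>c > 0\<close> by simp
      then show ?thesis
        using \<open>e > 0\<close> by (simp add: dist_norm power2_less_imp_less)
    qed
    then show "\<exists>M. \<forall>k\<ge>M. \<forall>l\<ge>M. dist (X k) (X l) < e" by blast
  qed
  then obtain x where x: "X \<longlonglongrightarrow> x"
    using convergent_def Cauchy_convergent by blast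
  have "f i x \<le> m" if i: "i \<in> I" for i
  proof (rule LIMSEQ_le)
    show "(\<lambda>k. f i (X k)) \<longlonglongrightarrow> f i x"
      using continuous_on_tendsto_compose[OF cont[OF i] x] by simp
    show "(\<lambda>k. m + 1 / Suc k) \<longlonglongrightarrow> m"
      using tendsto_add[OF tendsto_const LIMSEQ_inverse_real_of_nat, of m]
      by (simp add: inverse_eq_divide)
  qed (use X[OF i] in auto)
  then show ?thesis
    using m_le that by blast
qed

text \<open>Simons and Zalinescu: at the minimizer \<open>(p, q)\<close> of \<open>F(z) + \<parallel>z\<parallel>\<^sup>2 / 2\<close>, where
  \<open>F(x, u) = sup {y \<bullet> u + v \<bullet> x - y \<bullet> v | v \<in> A y}\<close> is the Fitzpatrick function of \<open>A\<close>, the first-order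
  optimality condition and \<open>F(p, q) \<ge> p \<bullet> q\<close> show that \<open>(-q, -p)\<close> is monotonically related to the
  graph of \<open>A\<close>, and then that \<open>q = -p\<close>.\<close>

lemma maximally_monotone_zero:
  fixes A :: "'a::{real_inner, complete_space} \<Rightarrow> 'a set"
  assumes A: "maximally_monotone A"
  shows "\<exists>p. - p \<in> A p"
proof -
  define I where "I = {(y, v). v \<in> A y}"
  \<comment> \<open>Each \<open>g i\<close> is affine; the supremum of \<open>g i z\<close> over
    \<open>I\<close> is the Fitzpatrick function at \<open>z\<close>.\<close>
  define g where "g i z = z \<bullet> (snd i, fst i) - fst i \<bullet> snd i" for i z :: "'a \<times> 'a"
  define f where "f i z = g i z + (norm z)\<^sup>2 / 2" for i z :: "'a \<times> 'a"
  \<comment> \<open>An empty graph would make the condition of \<open>maximally_monotone_mem\<close>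
    vacuous and so put \<open>0\<close> into \<open>A 0\<close>.\<close>
  obtain y0 v0 where yv0: "v0 \<in> A y0"
    using maximally_monotone_mem[OF A, of 0 0] by blast
  have mono: "(u - v) \<bullet> (x - y) \<ge> 0" if "u \<in> A x" "v \<in> A y" for u v x y
    using A that by (auto simp: maximally_monotone_def monotone_op_def)
  \<comment> \<open>On the graph, monotonicity bounds the Fitzpatrick function by the inner product
    of the pair.\<close>
  have g_graph: "g i (y, v) \<le> y \<bullet> v" if "v \<in> A y" "i \<in> I" for i y v
    using mono[of v y "snd i" "fst i"] that
    by (auto simp: g_def I_def inner_diff_left inner_diff_right inner_commute)
  obtain z m where z: "\<forall>i\<in>I. f i z \<le> m" and m: "\<And>y r. (\<forall>i\<in>I. f i y \<le> r) \<Longrightarrow> m \<le> r"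
  proof (rule strongly_midpoint_convex_minimizer[of I f "1/8"])
    fix i and x y :: "'a \<times> 'a"
    \<comment> \<open>As \<open>g i\<close> is affine, the gain is that of half the squared norm,
      given by the parallelogram law.\<close>
    show "f i ((1/2) *\<^sub>R (x + y)) \<le> (f i x + f i y) / 2 - 1 / 8 * (norm (x - y))\<^sup>2"
      by (simp add: f_def g_def power2_norm_eq_inner algebra_simps inner_commute) argo
  next
    fix i :: "'a \<times> 'a"
    show "continuous_on UNIV (f i)"
      unfolding f_def g_def by (intro continuous_intros) simp
  next
    fix x r assume *: "\<forall>i\<in>I. f i x \<le> r"
    \<comment> \<open>A single graph point bounds the objective from below, by completing the
      square.\<close>
    let ?w = "(v0, y0)"
    have "0 \<le> (norm (x + ?w))\<^sup>2 / 2" by simp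
    also have "\<dots> = x \<bullet> ?w + (norm x)\<^sup>2 / 2 + (norm ?w)\<^sup>2 / 2"
      by (simp only: power2_norm_eq_inner inner_add_left inner_add_right inner_commute) simp
    finally show "- (norm ?w)\<^sup>2 / 2 - y0 \<bullet> v0 \<le> r"
      using *[rule_format, of "(y0, v0)"] yv0 by (simp add: f_def g_def I_def)
  next
    show "\<forall>i\<in>I. f i (y0, v0) \<le> y0 \<bullet> v0 + (norm (y0, v0))\<^sup>2 / 2"
      using g_graph[OF yv0] by (simp add: f_def)
  qed auto
  define s where "s = m - (norm z)\<^sup>2 / 2"
  have g_z: "g i z \<le> s" if "i \<in> I" for i
    using z that by (simp add: f_def s_def algebra_simps)
  obtain p q where pq: "z = (p, q)" by fastforce
  \<comment> \<open>Otherwise \<open>(p, q)\<close> is strictly monotonically related to every graph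
    point, hence lies in the graph by maximality; comparing it with itself gives
    \<open>0 > 0\<close>.\<close>
  have s_ge: "p \<bullet> q \<le> s"
  proof (rule ccontr)
    assume "\<not> p \<bullet> q \<le> s"
    then have *: "(q - v) \<bullet> (p - y) > 0" if "v \<in> A y" for y v
      using g_z[of "(y, v)"] that
      by (auto simp: g_def I_def pq inner_diff_left inner_diff_right inner_commute)
    then have "q \<in> A p"
      by (intro maximally_monotone_mem[OF A]) (auto intro: less_imp_le)
    with * show False by force
  qed
  \<comment> \<open>Move from \<open>z\<close> a fraction \<open>t\<close> of the way to the graph
    point. Convexity and \<open>g_graph\<close> bound the objective there, minimality of
    \<open>m\<close> leaves after division by \<open>t\<close> a defect of order \<open>t\<close>,
    and \<open>t\<close> tends to 0.\<close>
  have opt: "s + (norm z)\<^sup>2 \<le> y \<bullet> v + z \<bullet> (y, v)" if "v \<in> A y" for y v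
  proof -
    let ?w = "(y, v)"
    have step: "s + (norm z)\<^sup>2 - y \<bullet> v - z \<bullet> ?w \<le> t * ((norm (?w - z))\<^sup>2 / 2)" if t: "0 < t" "t < 1" for t
    proof -
      let ?zt = "z + t *\<^sub>R (?w - z)"
      have norm_zt: "(norm ?zt)\<^sup>2 = (norm z)\<^sup>2 + 2 * t * (z \<bullet> ?w - (norm z)\<^sup>2) + t\<^sup>2 * (norm (?w - z))\<^sup>2"
        by (simp only: power2_norm_eq_inner inner_add_left inner_add_right inner_diff_left
            inner_diff_right inner_scaleR_left inner_scaleR_right inner_commute)
          (simp add: algebra_simps power2_eq_square)
      have "\<forall>i\<in>I. f i ?zt \<le> (1 - t) * s + t * (y \<bullet> v) + (norm ?zt)\<^sup>2 / 2"
      proof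
        fix i assume i: "i \<in> I"
        have "g i ?zt = (1 - t) * g i z + t * g i ?w"
          unfolding g_def
          by (simp only: inner_add_left inner_diff_left inner_scaleR_left) (simp add: algebra_simps)
        also have "\<dots> \<le> (1 - t) * s + t * (y \<bullet> v)"
          using t g_z[OF i] g_graph[OF \<open>v \<in> A y\<close> i] by (intro add_mono mult_left_mono) auto
        finally show "f i ?zt \<le> (1 - t) * s + t * (y \<bullet> v) + (norm ?zt)\<^sup>2 / 2"
          by (simp add: f_def)
      qed
      from m[OF this] have "t * (s + (norm z)\<^sup>2 - y \<bullet> v - z \<bullet> ?w) \<le> t * (t * ((norm (?w - z))\<^sup>2 / 2))"
        unfolding s_def norm_zt power2_eq_square[of t] distrib_left right_diff_distrib by argo
      then show ?thesis using t(1) by (simp only: mult_le_cancel_left_pos)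
    qed
    have "((\<lambda>t. t * ((norm (?w - z))\<^sup>2 / 2)) \<longlongrightarrow> 0 * ((norm (?w - z))\<^sup>2 / 2)) (at_right 0)"
      by (intro tendsto_intros)
    then have "s + (norm z)\<^sup>2 - y \<bullet> v - z \<bullet> ?w \<le> 0 * ((norm (?w - z))\<^sup>2 / 2)"
    proof (rule tendsto_lowerbound)
      show "\<forall>\<^sub>F t in at_right 0. s + (norm z)\<^sup>2 - y \<bullet> v - z \<bullet> ?w \<le> t * ((norm (?w - z))\<^sup>2 / 2)"
        using step by (intro eventually_at_rightI[of 0 1]) auto
    qed simp
    then show ?thesis by simp
  qed
  \<comment> \<open>With \<open>s\<close> replaced by its lower bound, adding
    \<open>p \<bullet> q\<close> to both sides of \<open>opt\<close> completes the square on the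
    left.\<close>
  have key: "(norm (p + q))\<^sup>2 \<le> (- p - v) \<bullet> (- q - y)" if "v \<in> A y" for y v
    using opt[OF that] s_ge
    by (simp add: pq power2_norm_eq_inner norm_Pair algebra_simps inner_commute)
  have "- p \<in> A (- q)"
    using key by (intro maximally_monotone_mem[OF A]) (meson order_trans zero_le_power2)
  \<comment> \<open>At the graph point \<open>(- q, - p)\<close> the right-hand side of
    \<open>key\<close> vanishes.\<close>
  moreover from key[OF this] have "q = - p"
    by (simp add: add_eq_0_iff)
  ultimately show ?thesis by auto
qed

text \<open>The operator \<open>c A - y\<close> is again maximally monotone, because an element
  \<open>w\<close> of a monotone extension is carried back to \<open>A\<close> by
  \<open>(w + y) / c\<close>. A point \<open>p\<close> whose negative lies in its value at
  \<open>p\<close> solves the equation.\<close>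

lemma Minty:
  fixes A :: "'a::{real_inner, complete_space} \<Rightarrow> 'a set"
  assumes A: "maximally_monotone A" and c: "c > 0"
  shows "\<exists>x. \<exists>u\<in>A x. y = x + c *\<^sub>R u"
proof -
  define A' where "A' x = {c *\<^sub>R u - y |u. u \<in> A x}" for x
  have mono: "monotone_op A"
    using A by (simp add: maximally_monotone_def)
  have "monotone_op A'"
    unfolding monotone_op_def A'_def using mono c
    by (auto simp: monotone_op_def simp flip: scaleR_diff_right)
  moreover have "C = A'" if C: "monotone_op C" "A' \<le> C" for C
  proof (intro antisym \<open>A' \<le> C\<close> le_funI subsetI)
    fix x w assume w: "w \<in> C x"
    have "(1 / c) *\<^sub>R (w + y) \<in> A x"
    proof (rule maximally_monotone_mem[OF A])
      fix x' v assume "v \<in> A x'"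
      then have "c *\<^sub>R v - y \<in> C x'"
        using C(2) by (auto simp: A'_def le_fun_def)
      then have "0 \<le> (1 / c) * ((w - (c *\<^sub>R v - y)) \<bullet> (x - x'))"
        using C(1) w c by (auto simp: monotone_op_def)
      also have "\<dots> = ((1 / c) *\<^sub>R (w + y) - v) \<bullet> (x - x')"
        using c by (simp add: inner_diff_left inner_add_left field_simps)
      finally show "0 \<le> ((1 / c) *\<^sub>R (w + y) - v) \<bullet> (x - x')" .
    qed
    then show "w \<in> A' x"
      unfolding A'_def using c by (auto intro!: exI[of _ "(1 / c) *\<^sub>R (w + y)"])
  qed
  ultimately have "maximally_monotone A'"
    by (auto simp: maximally_monotone_def)
  then obtain p where "- p \<in> A' p"
    using maximally_monotone_zero by blast
  then show ?thesis
    by (force simp: A'_def algebra_simps)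
qed

section \<open>Resolvents of maximally monotone operators\<close>

lemma monotone_resolvent_contraction:
  assumes "monotone_op A" "c \<ge> 0" "u \<in> A x" "v \<in> A y"
  shows "norm (x - y) \<le> norm ((x + c *\<^sub>R u) - (y + c *\<^sub>R v))"
proof -
  \<comment> \<open>Pairing the difference of the inputs with \<open>x - y\<close>, monotonicity
    allows the \<open>c\<close> term to be added. Graph elements instead of \<open>resolvent\<close>
    make the estimate available for proving uniqueness.\<close>
  have "(norm (x - y))\<^sup>2 \<le> (x - y) \<bullet> (x - y) + c * ((u - v) \<bullet> (x - y))"
    using assms by (simp add: power2_norm_eq_inner monotone_op_def)
  also have "\<dots> = ((x + c *\<^sub>R u) - (y + c *\<^sub>R v)) \<bullet> (x - y)"
    by (simp add: algebra_simps)
  also have "\<dots> \<le> norm ((x + c *\<^sub>R u) - (y + c *\<^sub>R v)) * norm (x - y)"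
    by (rule norm_cauchy_schwarz)
  finally show ?thesis
    by (cases "x = y") (auto simp: power2_eq_square)
qed

text \<open>\<open>the_elem\<close> is meaningful only on a singleton: Minty's theorem gives
  existence, and the contraction estimate gives uniqueness.\<close>

lemma resolvent_scale_eq_iff:
  fixes A :: "'a::{real_inner, complete_space} \<Rightarrow> 'a set"
  assumes A: "maximally_monotone A" and c: "c > 0"
  shows "resolvent (scale_op c A) y = x \<longleftrightarrow> (1 / c) *\<^sub>R (y - x) \<in> A x"
proof -
  let ?S = "inverse_op (Id_plus (scale_op c A)) y"
  have S: "?S = {x. \<exists>u\<in>A x. y = x + c *\<^sub>R u}"
    by (auto simp: inverse_op_def Id_plus_def scale_op_def)
  obtain x0 where x0: "x0 \<in> ?S"
    unfolding S using Minty[OF A c] by blast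
  have "w = x0" if w: "w \<in> ?S" for w
  proof -
    obtain u where "u \<in> A w" and u: "y = w + c *\<^sub>R u"
      using w unfolding S by blast
    moreover obtain v where "v \<in> A x0" and v: "y = x0 + c *\<^sub>R v"
      using x0 unfolding S by blast
    ultimately have "norm (w - x0) \<le> norm ((w + c *\<^sub>R u) - (x0 + c *\<^sub>R v))"
      using A c by (intro monotone_resolvent_contraction) (auto simp: maximally_monotone_def)
    then show ?thesis by (simp flip: u v)
  qed
  then have "?S = {x0}" using x0 by blast
  then have "resolvent (scale_op c A) y = x \<longleftrightarrow> x \<in> ?S"
    by (auto simp: resolvent_def)
  also have "\<dots> \<longleftrightarrow> (1 / c) *\<^sub>R (y - x) \<in> A x"
    using c by (auto simp: S intro!: bexI[of _ "(1 / c) *\<^sub>R (y - x)"])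
  finally show ?thesis .
qed

lemma resolvent_scale_nonexpansive:
  fixes A :: "'a::{real_inner, complete_space} \<Rightarrow> 'a set"
  assumes "maximally_monotone A" "c > 0"
  shows "norm (resolvent (scale_op c A) y - resolvent (scale_op c A) w) \<le> norm (y - w)"
proof -
  let ?J = "resolvent (scale_op c A)"
  have J: "(1 / c) *\<^sub>R (v - ?J v) \<in> A (?J v)" for v
    using resolvent_scale_eq_iff[OF assms] by blast
  have "norm (?J y - ?J w) \<le>
      norm ((?J y + c *\<^sub>R ((1 / c) *\<^sub>R (y - ?J y))) - (?J w + c *\<^sub>R ((1 / c) *\<^sub>R (w - ?J w))))"
    using assms J by (intro monotone_resolvent_contraction) (auto simp: maximally_monotone_def)
  then show ?thesis using assms by simp
qed

text \<open>\<open>(w - x) / (t c)\<close> equals \<open>(y - x) / c\<close>, so the same element of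
  \<open>A x\<close> certifies both resolvent values.\<close>

lemma resolvent_scale_relocate:
  fixes A :: "'a::{real_inner, complete_space} \<Rightarrow> 'a set"
  assumes "maximally_monotone A" "c > 0" "t > 0"
    and "resolvent (scale_op c A) y = x" "w - x = t *\<^sub>R (y - x)"
  shows "resolvent (scale_op (t * c) A) w = x"
  using assms by (simp add: resolvent_scale_eq_iff)

section \<open>Relocators for a spanning subgraph\<close>

lemma (in pair_wf_digraph) in_degree_with_proj:
  "in_degree (with_proj G) i = card {j. (j, i) \<in> parcs G}"
proof -
  have "in_arcs (with_proj G) i = (\<lambda>j. (j, i)) ` {j. (j, i) \<in> parcs G}"
    by (auto simp: in_arcs_def)
  then show ?thesis
    by (simp add: in_degree_def card_image inj_on_def)
qed

lemma degree_gap_out_minus_in: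
  "degree_gap G i = real (out_degree (with_proj G) i) - real (in_degree (with_proj G) i)"
  by (simp add: degree_gap_def node_degree_def)

text \<open>Counting the arcs by tail and by head gives the same number. This settles the row of the
  incidence matrix at the centre of a star and at the end of the path.\<close>

lemma sum_degree_gap:
  assumes "pair_fin_digraph G"
  shows "(\<Sum>i\<in>pverts G. degree_gap G i) = 0"
proof -
  interpret pair_fin_digraph G by fact
  have "(\<Sum>i\<in>pverts G. card {e \<in> parcs G. f e = i}) = card (parcs G)"
    if "\<And>e. e \<in> parcs G \<Longrightarrow> f e \<in> pverts G" for f
    using sum.group[OF pair_finite_arcs pair_finite_verts, of f "\<lambda>_. 1 :: nat"]
      image_subsetI[of "parcs G" f, OF that] by simp
  from this[of fst] this[of snd] have
    "(\<Sum>i\<in>pverts G. out_degree (with_proj G) i) = (\<Sum>i\<in>pverts G. in_degree (with_proj G) i)"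
    by (simp add: in_degree_def out_degree_def in_arcs_def out_arcs_def
        arc_fst_in_verts arc_snd_in_verts)
  then show ?thesis
    by (simp add: degree_gap_out_minus_in sum_subtractf flip: of_nat_sum)
qed

lemma atin_within_euclidean: "atin_within euclidean a S = at a within S"
  by (auto simp: filter_eq_iff eventually_atin_within eventually_at_topological)

text \<open>At a fixed point of \<open>T\<close> these column sums vanish, so each tree arc equates
  the components at its two ends.\<close>

lemma sum_Inc_column:
  fixes x :: "nat \<Rightarrow> 'a::real_vector"
  assumes "e i = (a, b)" "a \<in> {1..n}" "b \<in> {1..n}" "a \<noteq> b"
  shows "(\<Sum>j=1..n. Inc e j i *\<^sub>R x j) = x a - x b"
proof -
  have "Inc e j i *\<^sub>R x j = (if j = a then x a else 0) - (if j = b then x b else 0)" for j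
    using assms by (simp add: Inc_def)
  then have "(\<Sum>j=1..n. Inc e j i *\<^sub>R x j)
      = (\<Sum>j=1..n. if j = a then x a else 0) - (\<Sum>j=1..n. if j = b then x b else 0)"
    by (simp only: sum_subtractf)
  also have "\<dots> = x a - x b"
    using assms by (simp only: sum.delta' sum.delta finite_atLeastAtMost if_True)
  finally show ?thesis .
qed

text \<open>The relocators of all three trees have the form
  \<open>(Q z)\<^sub>i = (\<delta>/\<gamma>) z\<^sub>i + (1 - \<delta>/\<gamma>) c\<^sub>i x\<^sub>1\<^sup>\<gamma>(z)\<close> with \<open>Inc(G') c\<close> the vector of degree gaps; apart from this
  only \<open>ker Inc(G')\<^sup>T = {(x, \<dots>, x)}\<close> is used about the tree.\<close>

locale spanning_relocation = pair_digraph G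
  for G :: "nat pair_pre_digraph" +
  fixes n :: nat
    and A :: "nat \<Rightarrow> 'a::{real_inner, complete_space} \<Rightarrow> 'a set"
    and B :: "nat \<Rightarrow> 'a \<Rightarrow> 'a"
    and h :: "nat \<Rightarrow> nat"
    and e :: "nat \<Rightarrow> nat \<times> nat"
    and c :: "nat \<Rightarrow> real"
  assumes n_ge_2: "n \<ge> 2"
    and A_max: "\<And>i. i \<in> {1..n} \<Longrightarrow> maximally_monotone (A i)"
    and verts: "pverts G = {1..n}"
    and arc_less: "\<And>i j. (i, j) \<in> parcs G \<Longrightarrow> i < j"
    and h_arc: "\<And>i. i \<in> {2..n} \<Longrightarrow> (h i, i) \<in> parcs G"
    and Inc_c: "\<And>i. i \<in> {1..n} \<Longrightarrow> (\<Sum>j=1..n-1. Inc e i j * c j) = degree_gap G i"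
    and Inc_kernel: "\<And>x :: nat \<Rightarrow> 'a. (\<And>j. j \<in> {1..n-1} \<Longrightarrow> (\<Sum>i=1..n. Inc e i j *\<^sub>R x i) = 0)
      \<Longrightarrow> (\<And>i. i \<in> {1..n} \<Longrightarrow> x i = x 1)"
begin

abbreviation x where "x \<equiv> x_map n G e h A B"

abbreviation T where "T \<equiv> T_op n G e h A B"

abbreviation \<kappa> where "\<kappa> \<equiv> node_degree G"

definition Q :: "real \<Rightarrow> real \<Rightarrow> (nat \<Rightarrow> 'a) \<Rightarrow> nat \<Rightarrow> 'a" where
  "Q \<delta> \<gamma> z = (\<lambda>i\<in>{1..n-1}. (\<delta> / \<gamma>) *\<^sub>R z i + ((1 - \<delta> / \<gamma>) * c i) *\<^sub>R x \<gamma> z 1)"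

definition tree_input :: "nat \<Rightarrow> (nat \<Rightarrow> 'a) \<Rightarrow> 'a" where
  "tree_input i z = (\<Sum>j=1..n-1. Inc e i j *\<^sub>R z j)"

section \<open>Components of the resolvent map and the composition law of \<open>Q\<close>\<close>

lemma arc_bounds:
  assumes "(i, j) \<in> parcs G"
  shows "1 \<le> i" "i < j" "j \<le> n"
  using arc_less[OF assms] in_arcsD1[OF assms] in_arcsD2[OF assms] by (auto simp: verts)

text \<open>Each node other than 1 has the entering arc from \<open>h i\<close>. Node 1 has no
  entering arc, but \<open>h 2 < 2\<close> forces the arc \<open>(1, 2)\<close>.\<close>

lemma node_degree_pos:
  assumes "i \<in> {1..n}"
  shows "\<kappa> i > 0"
proof (cases "i = 1")
  case True
  have "h 2 = 1"
    using arc_bounds[OF h_arc[of 2]] n_ge_2 by auto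
  then have "(1, 2) \<in> out_arcs (with_proj G) 1"
    using h_arc[of 2] n_ge_2 by (auto simp: out_arcs_def)
  moreover have "finite (out_arcs (with_proj G) 1)"
    using pair_finite_arcs by (simp add: out_arcs_def)
  ultimately have "out_degree (with_proj G) 1 > 0"
    unfolding out_degree_def card_gt_0_iff by blast
  then show ?thesis
    by (simp add: True node_degree_def)
next
  case False
  then have "(h i, i) \<in> in_arcs (with_proj G) i"
    using h_arc[of i] assms by (auto simp: in_arcs_def)
  moreover have "finite (in_arcs (with_proj G) i)"
    using pair_finite_arcs by (simp add: in_arcs_def)
  ultimately have "in_degree (with_proj G) i > 0"
    unfolding in_degree_def card_gt_0_iff by blast
  then show ?thesis
    by (simp add: node_degree_def)
qed

lemma in_degree_1: "in_degree (with_proj G) 1 = 0"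
proof -
  have "{j. (j, 1) \<in> parcs G} = {}"
    using arc_bounds by fastforce
  then show ?thesis
    by (simp only: in_degree_with_proj card.empty)
qed

lemma x_1:
  "x \<gamma> z 1 = resolvent (scale_op (\<gamma> / \<kappa> 1) (A 1)) ((1 / \<kappa> 1) *\<^sub>R tree_input 1 z)"
  using x_map_1[of n G e h A B \<gamma> z] n_ge_2 by (simp add: tree_input_def)

text \<open>All predecessors of \<open>i\<close>, among them \<open>h i\<close>, are smaller than
  \<open>i\<close>. Assuming constancy only below \<open>i\<close> lets the formula be applied
  inside an induction over the nodes.\<close>

lemma x_step_const:
  assumes i: "i \<in> {2..n}" and const: "\<And>j. 1 \<le> j \<Longrightarrow> j < i \<Longrightarrow> x \<gamma> z j = p"
  shows "x \<gamma> z i = resolvent (scale_op (\<gamma> / \<kappa> i) (A i))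
    ((1 / \<kappa> i) *\<^sub>R ((2 * real (in_degree (with_proj G) i)) *\<^sub>R p - \<gamma> *\<^sub>R B (i - 1) p + tree_input i z))"
proof -
  have "x \<gamma> z (h i) = p"
    using arc_bounds[OF h_arc[OF i]] const by blast
  moreover have "(\<Sum>j\<in>{j. (j, i) \<in> parcs G}. x \<gamma> z j) = real (in_degree (with_proj G) i) *\<^sub>R p"
    using arc_bounds const by (simp add: in_degree_with_proj sum_constant_scaleR)
  ultimately show ?thesis
    by (subst x_map_step[OF i]) (use arc_less h_arc[OF i] in
      \<open>simp_all add: tree_input_def scaleR_add_right scaleR_diff_right\<close>)
qed

lemma tree_input_Q:
  assumes "i \<in> {1..n}"
  shows "tree_input i (Q \<delta> \<gamma> z)
    = (\<delta> / \<gamma>) *\<^sub>R tree_input i z + ((1 - \<delta> / \<gamma>) * degree_gap G i) *\<^sub>R x \<gamma> z 1"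
proof -
  have "tree_input i (Q \<delta> \<gamma> z) = (\<Sum>j=1..n-1. (\<delta> / \<gamma>) *\<^sub>R (Inc e i j *\<^sub>R z j)
      + ((1 - \<delta> / \<gamma>) * (Inc e i j * c j)) *\<^sub>R x \<gamma> z 1)"
    unfolding tree_input_def Q_def
    by (intro sum.cong) (simp_all add: scaleR_add_right mult_ac)
  also have "\<dots> = (\<delta> / \<gamma>) *\<^sub>R tree_input i z
      + ((1 - \<delta> / \<gamma>) * (\<Sum>j=1..n-1. Inc e i j * c j)) *\<^sub>R x \<gamma> z 1"
    by (simp only: sum.distrib tree_input_def scaleR_sum_right scaleR_sum_left sum_distrib_left)
  finally show ?thesis
    by (simp only: Inc_c[OF assms])
qed

lemma x_1_Q:
  assumes "\<delta> > 0" "\<gamma> > 0"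
  shows "x \<delta> (Q \<delta> \<gamma> z) 1 = x \<gamma> z 1"
proof -
  define k where "k = real (\<kappa> 1)"
  have k: "k > 0"
    using node_degree_pos[of 1] n_ge_2 by (simp add: k_def)
  \<comment> \<open>With no entering arcs the gap is the full degree, so dividing by
    \<open>k\<close> leaves exactly the coefficient \<open>1 - ?t\<close> on the old
    component.\<close>
  have gap: "degree_gap G 1 = k"
    using in_degree_1 by (simp add: degree_gap_def k_def)
  let ?t = "\<delta> / \<gamma>" and ?y = "(1 / k) *\<^sub>R tree_input 1 z"
  have "tree_input 1 (Q \<delta> \<gamma> z) = ?t *\<^sub>R tree_input 1 z + ((1 - ?t) * k) *\<^sub>R x \<gamma> z 1"
    using tree_input_Q[of 1] n_ge_2 gap by simp
  then have "(1 / k) *\<^sub>R tree_input 1 (Q \<delta> \<gamma> z) - x \<gamma> z 1 = ?t *\<^sub>R (?y - x \<gamma> z 1)"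
    using k by (simp only: scaleR_add_right scaleR_diff_right) (simp add: algebra_simps)
  then have "resolvent (scale_op (?t * (\<gamma> / k)) (A 1)) ((1 / k) *\<^sub>R tree_input 1 (Q \<delta> \<gamma> z)) = x \<gamma> z 1"
    using A_max[of 1] n_ge_2 assms k x_1[of \<gamma> z]
    by (intro resolvent_scale_relocate[where y = ?y]) (simp_all add: k_def)
  then show ?thesis
    using assms x_1[of \<delta> "Q \<delta> \<gamma> z"] by (simp add: k_def)
qed

lemma Q_in_tuples: "Q \<delta> \<gamma> z \<in> tuples (n-1)"
  by (simp add: Q_def tuples_def)

text \<open>With \<open>X\<close> the tuple of all \<open>c i *\<^sub>R x \<gamma> z 1\<close>,
  \<open>Q\<close> scales \<open>z - X\<close> by \<open>\<delta> / \<gamma>\<close>. By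
  \<open>x_1_Q\<close> the next step has the same \<open>X\<close>, so the factors multiply, for
  arbitrary \<open>z\<close>.\<close>

lemma Q_Q:
  assumes "\<epsilon> > 0" "\<delta> > 0" "\<gamma> > 0"
  shows "Q \<epsilon> \<delta> (Q \<delta> \<gamma> z) = Q \<epsilon> \<gamma> z"
proof
  fix i
  let ?X = "c i *\<^sub>R x \<gamma> z 1"
  have Q_i: "Q \<delta> \<gamma> z i = (\<delta> / \<gamma>) *\<^sub>R z i + (1 - \<delta> / \<gamma>) *\<^sub>R c i *\<^sub>R x \<gamma> z 1"
    if "i \<in> {1..n-1}" for \<delta> \<gamma> z
    using that by (simp add: Q_def)
  have eq: "(\<epsilon> / \<delta>) *\<^sub>R ((\<delta> / \<gamma>) *\<^sub>R z i + (1 - \<delta> / \<gamma>) *\<^sub>R ?X) + (1 - \<epsilon> / \<delta>) *\<^sub>R ?X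
      = (\<epsilon> / \<gamma>) *\<^sub>R z i + (1 - \<epsilon> / \<gamma>) *\<^sub>R ?X"
    using assms by (simp add: algebra_simps)
  show "Q \<epsilon> \<delta> (Q \<delta> \<gamma> z) i = Q \<epsilon> \<gamma> z i"
  proof (cases "i \<in> {1..n-1}")
    case True
    then show ?thesis
      using eq by (simp only: Q_i x_1_Q[OF assms(2,3)])
  next
    case False
    then show ?thesis by (auto simp: Q_def)
  qed
qed

lemma Q_same:
  assumes "\<gamma> > 0" "z \<in> tuples (n-1)"
  shows "Q \<gamma> \<gamma> z = z"
  using assms by (auto simp: Q_def tuples_def PiE_iff extensional_def fun_eq_iff)

section \<open>Fixed points of \<open>T\<close> and their images under \<open>Q\<close>\<close>

lemma Fix_T_iff:
  assumes "\<theta> > 0"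
  shows "z \<in> Fix (tuples (n-1)) (T \<theta> \<gamma>)
    \<longleftrightarrow> z \<in> tuples (n-1) \<and> (\<forall>j\<in>{1..n-1}. (\<Sum>i=1..n. Inc e i j *\<^sub>R x \<gamma> z i) = 0)"
  using assms by (auto simp: Fix_def T_op_def tuples_def PiE_iff extensional_def fun_eq_iff)

lemma Fix_T_const:
  assumes "\<theta> > 0" "z \<in> Fix (tuples (n-1)) (T \<theta> \<gamma>)" "i \<in> {1..n}"
  shows "x \<gamma> z i = x \<gamma> z 1"
  using assms(2,3) unfolding Fix_T_iff[OF assms(1)] by (intro Inc_kernel) auto

text \<open>Strong induction over the nodes: once all earlier components of the relocated point
  equal the common value \<open>p\<close>, \<open>x_step_const\<close> describes node
  \<open>i\<close> for both parameters.\<close>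

lemma x_Q_Fix:
  assumes "\<theta> > 0" "\<delta> > 0" "\<gamma> > 0" and z: "z \<in> Fix (tuples (n-1)) (T \<theta> \<gamma>)"
  shows "i \<in> {1..n} \<Longrightarrow> x \<delta> (Q \<delta> \<gamma> z) i = x \<gamma> z i"
proof (induction i rule: less_induct)
  case (less i)
  show ?case
  proof (cases "i = 1")
    case False
    with less.prems have i: "i \<in> {2..n}" by auto
    define p where "p = x \<gamma> z 1"
    have const: "x \<gamma> z j = p" if "j \<in> {1..n}" for j
      using Fix_T_const[OF \<open>\<theta> > 0\<close> z that] by (simp add: p_def)
    have const_Q: "x \<delta> (Q \<delta> \<gamma> z) j = p" if "1 \<le> j" "j < i" for j
      using less.IH[of j] const[of j] that less.prems by auto
    define k d where "k = real (\<kappa> i)" and "d = real (in_degree (with_proj G) i)"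
    have k: "k > 0"
      using node_degree_pos less.prems by (simp add: k_def)
    have gap: "degree_gap G i = k - 2 * d"
      by (simp add: degree_gap_def k_def d_def)
    define y where "y \<epsilon> w = (1 / k) *\<^sub>R ((2 * d) *\<^sub>R p - \<epsilon> *\<^sub>R B (i - 1) p + tree_input i w)" for \<epsilon> w
    have x_z: "x \<gamma> z i = resolvent (scale_op (\<gamma> / k) (A i)) (y \<gamma> z)"
      unfolding y_def k_def d_def using const i by (intro x_step_const) auto
    have x_Q: "x \<delta> (Q \<delta> \<gamma> z) i = resolvent (scale_op (\<delta> / k) (A i)) (y \<delta> (Q \<delta> \<gamma> z))"
      unfolding y_def k_def d_def using const_Q i by (intro x_step_const) auto
    let ?t = "\<delta> / \<gamma>"
    have "tree_input i (Q \<delta> \<gamma> z) = ?t *\<^sub>R tree_input i z + ((1 - ?t) * (k - 2 * d)) *\<^sub>R p"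
      using tree_input_Q[OF less.prems] by (simp only: gap p_def)
    \<comment> \<open>The coefficients of \<open>p\<close> on the left sum to
      \<open>2 d + (1 - ?t) (k - 2 d) - k = ?t (2 d - k)\<close>, and
      \<open>\<delta> = ?t \<gamma>\<close> takes care of the \<open>B\<close> term.\<close>
    then have eq: "k *\<^sub>R (y \<delta> (Q \<delta> \<gamma> z) - p) = k *\<^sub>R (?t *\<^sub>R (y \<gamma> z - p))"
      using k \<open>\<gamma> > 0\<close>
      by (simp add: y_def algebra_simps)
    then have "y \<delta> (Q \<delta> \<gamma> z) - p = ?t *\<^sub>R (y \<gamma> z - p)"
      using k by (intro scaleR_left_imp_eq[OF _ eq]) simp
    then have "resolvent (scale_op (?t * (\<gamma> / k)) (A i)) (y \<delta> (Q \<delta> \<gamma> z)) = p"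
      using A_max[OF less.prems] assms k x_z const[OF less.prems]
      by (intro resolvent_scale_relocate[where y = "y \<gamma> z"]) simp_all
    then show ?thesis
      using x_Q const[OF less.prems] \<open>\<gamma> > 0\<close> by simp
  qed (use x_1_Q assms in simp)
qed

lemma Q_Fix:
  assumes "\<theta> > 0" "\<delta> > 0" "\<gamma> > 0" and z: "z \<in> Fix (tuples (n-1)) (T \<theta> \<gamma>)"
  shows "Q \<delta> \<gamma> z \<in> Fix (tuples (n-1)) (T \<theta> \<delta>)"
proof -
  have "(\<Sum>i=1..n. Inc e i j *\<^sub>R x \<delta> (Q \<delta> \<gamma> z) i) = (\<Sum>i=1..n. Inc e i j *\<^sub>R x \<gamma> z i)" for j
    by (intro sum.cong refl arg_cong2[where f = scaleR] x_Q_Fix[OF assms])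
  with z have "\<forall>j\<in>{1..n-1}. (\<Sum>i=1..n. Inc e i j *\<^sub>R x \<delta> (Q \<delta> \<gamma> z) i) = 0"
    by (simp only: Fix_T_iff[OF assms(1)]) blast
  then show ?thesis
    unfolding Fix_T_iff[OF assms(1)] using Q_in_tuples by blast
qed

lemma Q_bij_betw:
  assumes "\<theta> > 0" "\<delta> > 0" "\<gamma> > 0"
  shows "bij_betw (Q \<delta> \<gamma>) (Fix (tuples (n-1)) (T \<theta> \<gamma>)) (Fix (tuples (n-1)) (T \<theta> \<delta>))"
proof (rule bij_betw_byWitness[where f' = "Q \<gamma> \<delta>"])
  have inverse: "Q \<epsilon> \<epsilon>' (Q \<epsilon>' \<epsilon> z) = z" if "z \<in> tuples (n-1)" "\<epsilon> > 0" "\<epsilon>' > 0" for z \<epsilon> \<epsilon>'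
    by (simp only: Q_Q Q_same that)
  show "\<forall>z\<in>Fix (tuples (n-1)) (T \<theta> \<gamma>). Q \<gamma> \<delta> (Q \<delta> \<gamma> z) = z"
    "\<forall>z\<in>Fix (tuples (n-1)) (T \<theta> \<delta>). Q \<delta> \<gamma> (Q \<gamma> \<delta> z) = z"
    using assms inverse unfolding Fix_def by blast+
next
  show "Q \<delta> \<gamma> ` Fix (tuples (n-1)) (T \<theta> \<gamma>) \<subseteq> Fix (tuples (n-1)) (T \<theta> \<delta>)"
    by (rule image_subsetI) (rule Q_Fix[OF assms])
  show "Q \<gamma> \<delta> ` Fix (tuples (n-1)) (T \<theta> \<delta>) \<subseteq> Fix (tuples (n-1)) (T \<theta> \<gamma>)"
    by (rule image_subsetI) (rule Q_Fix[OF assms(1,3,2)])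
qed

section \<open>Lipschitz continuity of \<open>Q\<close> and continuity in the target
  parameter\<close>

lemma x_1_Lipschitz:
  assumes "\<gamma> > 0"
  shows "norm (x \<gamma> z 1 - x \<gamma> w 1) \<le> (\<Sum>j=1..n-1. \<bar>Inc e 1 j\<bar>) / \<kappa> 1 * l2_dist (n-1) z w"
proof -
  have k: "\<kappa> 1 > 0"
    using node_degree_pos[of 1] n_ge_2 by simp
  \<comment> \<open>The input at node 1 is linear in \<open>z\<close>, and the resolvent is
    nonexpansive.\<close>
  have "norm (x \<gamma> z 1 - x \<gamma> w 1) \<le> norm ((1 / \<kappa> 1) *\<^sub>R tree_input 1 z - (1 / \<kappa> 1) *\<^sub>R tree_input 1 w)"
    unfolding x_1 using A_max[of 1] n_ge_2 k assms by (intro resolvent_scale_nonexpansive) auto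
  also have "(1 / \<kappa> 1) *\<^sub>R tree_input 1 z - (1 / \<kappa> 1) *\<^sub>R tree_input 1 w
      = (1 / \<kappa> 1) *\<^sub>R (\<Sum>j=1..n-1. Inc e 1 j *\<^sub>R (z j - w j))"
    by (simp only: tree_input_def scaleR_diff_right sum_subtractf)
  also have "norm \<dots> = (1 / \<kappa> 1) * norm (\<Sum>j=1..n-1. Inc e 1 j *\<^sub>R (z j - w j))"
    by simp
  also have "\<dots> \<le> (1 / \<kappa> 1) * (\<Sum>j=1..n-1. \<bar>Inc e 1 j\<bar> * l2_dist (n-1) z w)"
  proof (intro mult_left_mono)
    have "norm (Inc e 1 j *\<^sub>R (z j - w j)) \<le> \<bar>Inc e 1 j\<bar> * l2_dist (n-1) z w" if "j \<in> {1..n-1}" for j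
      using member_le_L2_set[OF _ that, of "\<lambda>i. norm (z i - w i)"]
      unfolding l2_dist_def norm_scaleR by (intro mult_left_mono) auto
    then show "norm (\<Sum>j=1..n-1. Inc e 1 j *\<^sub>R (z j - w j)) \<le> (\<Sum>j=1..n-1. \<bar>Inc e 1 j\<bar> * l2_dist (n-1) z w)"
      by (rule sum_norm_le)
  qed simp
  also have "\<dots> = (\<Sum>j=1..n-1. \<bar>Inc e 1 j\<bar>) / \<kappa> 1 * l2_dist (n-1) z w"
    by (simp only: sum_distrib_right[symmetric] times_divide_eq_left mult_1)
  finally show ?thesis .
qed

lemma Q_Lipschitz:
  assumes "\<delta> > 0" "\<gamma> > 0"
  shows "\<exists>K\<ge>1. \<forall>z w. l2_dist (n-1) (Q \<delta> \<gamma> z) (Q \<delta> \<gamma> w) \<le> K * l2_dist (n-1) z w"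
proof -
  define M where "M = (\<Sum>j=1..n-1. \<bar>Inc e 1 j\<bar>) / \<kappa> 1"
  define C where "C = L2_set (\<lambda>i. \<bar>(1 - \<delta> / \<gamma>) * c i\<bar>) {1..n-1}"
  have C: "C \<ge> 0" by (simp add: C_def)
  \<comment> \<open>Minkowski's inequality separates the scaled tuple from the shift along
    \<open>c\<close>. The maximum with 1 meets the requirement on the constants of
    relocators.\<close>
  have "l2_dist (n-1) (Q \<delta> \<gamma> z) (Q \<delta> \<gamma> w) \<le> max 1 (\<delta> / \<gamma> + C * M) * l2_dist (n-1) z w" for z w
  proof -
    let ?D = "norm (x \<gamma> z 1 - x \<gamma> w 1)"
    have "l2_dist (n-1) (Q \<delta> \<gamma> z) (Q \<delta> \<gamma> w)
        \<le> L2_set (\<lambda>i. \<delta> / \<gamma> * norm (z i - w i) + ?D * \<bar>(1 - \<delta> / \<gamma>) * c i\<bar>) {1..n-1}"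
      unfolding l2_dist_def
    proof (rule L2_set_mono)
      fix i assume "i \<in> {1..n-1}"
      then have "Q \<delta> \<gamma> z i - Q \<delta> \<gamma> w i
          = (\<delta> / \<gamma>) *\<^sub>R (z i - w i) + ((1 - \<delta> / \<gamma>) * c i) *\<^sub>R (x \<gamma> z 1 - x \<gamma> w 1)"
        by (simp add: Q_def scaleR_diff_right)
      then show "norm (Q \<delta> \<gamma> z i - Q \<delta> \<gamma> w i)
          \<le> \<delta> / \<gamma> * norm (z i - w i) + ?D * \<bar>(1 - \<delta> / \<gamma>) * c i\<bar>"
        using assms by (auto intro!: norm_triangle_le simp: mult.commute)
    qed simp
    also have "\<dots> \<le> L2_set (\<lambda>i. \<delta> / \<gamma> * norm (z i - w i)) {1..n-1}
        + L2_set (\<lambda>i. ?D * \<bar>(1 - \<delta> / \<gamma>) * c i\<bar>) {1..n-1}"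
      by (rule L2_set_triangle_ineq)
    also have "\<dots> = \<delta> / \<gamma> * l2_dist (n-1) z w + ?D * C"
      using assms by (simp only: L2_set_right_distrib[symmetric] l2_dist_def C_def norm_ge_zero
          divide_nonneg_pos less_imp_le)
    also have "\<dots> \<le> \<delta> / \<gamma> * l2_dist (n-1) z w + (M * l2_dist (n-1) z w) * C"
      using x_1_Lipschitz[OF assms(2), of z w] C
      by (intro add_left_mono mult_right_mono) (simp_all add: M_def)
    also have "\<dots> = (\<delta> / \<gamma> + C * M) * l2_dist (n-1) z w"
      by (simp add: algebra_simps)
    also have "\<dots> \<le> max 1 (\<delta> / \<gamma> + C * M) * l2_dist (n-1) z w"
      by (intro mult_right_mono) (simp_all add: l2_dist_def)
    finally show ?thesis .
  qed
  then show ?thesis by (intro exI[of _ "max 1 (\<delta> / \<gamma> + C * M)"]) auto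
qed

lemma Q_continuous:
  "continuous_map (top_of_set {0<..}) (Metric_space.mtopology (tuples (n-1)) (l2_dist (n-1)))
     (\<lambda>\<delta>. Q \<delta> \<gamma> z)"
proof -
  interpret M: Metric_space "tuples (n-1)" "l2_dist (n-1) :: (nat \<Rightarrow> 'a) \<Rightarrow> _"
    by (rule Metric_space_l2)
  have "((\<lambda>\<delta>. l2_dist (n-1) (Q \<delta> \<gamma> z) (Q \<delta>\<^sub>0 \<gamma> z)) \<longlongrightarrow> 0) (at \<delta>\<^sub>0 within {0<..})" for \<delta>\<^sub>0
  proof -
    have "((\<lambda>\<delta>. \<Sum>i=1..n-1. norm (Q \<delta> \<gamma> z i - Q \<delta>\<^sub>0 \<gamma> z i)) \<longlongrightarrow>
        (\<Sum>i=1..n-1. norm (Q \<delta>\<^sub>0 \<gamma> z i - Q \<delta>\<^sub>0 \<gamma> z i))) (at \<delta>\<^sub>0 within {0<..})"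
      unfolding Q_def restrict_def divide_inverse
      by (intro tendsto_sum tendsto_norm tendsto_diff tendsto_const)
        (auto intro!: tendsto_intros)
    then have lim: "((\<lambda>\<delta>. \<Sum>i=1..n-1. norm (Q \<delta> \<gamma> z i - Q \<delta>\<^sub>0 \<gamma> z i)) \<longlongrightarrow> 0) (at \<delta>\<^sub>0 within {0<..})"
      by simp
    \<comment> \<open>The \<open>l2_dist\<close> is squeezed between 0 and the sum of the
      componentwise distances.\<close>
    show ?thesis
      by (rule tendsto_sandwich[OF _ _ tendsto_const lim])
        (auto simp: l2_dist_def intro!: always_eventually L2_set_le_sum)
  qed
  then show ?thesis
    by (simp add: continuous_map_atin M.limitin_metric_dist_null Q_in_tuples
        atin_subtopology_within atin_within_euclidean del: One_nat_def)
qed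

theorem Q_relocators:
  assumes "\<theta> > 0"
  shows "\<exists>L. fixed_point_relocators (tuples (n-1)) (l2_dist (n-1)) {0<..} (T \<theta>) Q L"
proof -
  \<comment> \<open>Positivity is assumed inside the existential so that \<open>L\<close> can be
    chosen on all pairs of reals.\<close>
  have "\<forall>\<delta> \<gamma>. \<exists>K. \<delta> > 0 \<longrightarrow> \<gamma> > 0 \<longrightarrow>
      K \<ge> 1 \<and> (\<forall>z w. l2_dist (n-1) (Q \<delta> \<gamma> z) (Q \<delta> \<gamma> w) \<le> K * l2_dist (n-1) z w)"
    using Q_Lipschitz by meson
  then obtain L where L: "\<And>\<delta> \<gamma>. \<delta> > 0 \<Longrightarrow> \<gamma> > 0 \<Longrightarrow> L \<delta> \<gamma> \<ge> 1
      \<and> (\<forall>z w. l2_dist (n-1) (Q \<delta> \<gamma> z) (Q \<delta> \<gamma> w) \<le> L \<delta> \<gamma> * l2_dist (n-1) z w)"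
    by metis
  have "T \<theta> \<gamma> z \<in> tuples (n-1)" for \<gamma> z
    by (simp add: T_op_def tuples_def)
  then have "fixed_point_relocators (tuples (n-1)) (l2_dist (n-1)) {0<..} (T \<theta>) Q L"
    unfolding fixed_point_relocators_def
    using L Q_bij_betw[OF assms] Q_continuous Q_Q Q_in_tuples by auto
  then show ?thesis by blast
qed

end

section \<open>The three trees\<close>

theorem proposition5p5:
  fixes n :: nat and \<beta> :: real
    and A :: "nat \<Rightarrow> 'a::{real_inner, complete_space} \<Rightarrow> 'a set"
    and B :: "nat \<Rightarrow> 'a \<Rightarrow> 'a"
    and G :: "nat pair_pre_digraph"
    and h :: "nat \<Rightarrow> nat"
  assumes "n \<ge> 2" and "\<beta> > 0"
    and "\<forall>i\<in>{1..n}. maximally_monotone (A i)"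
    and "\<forall>i\<in>{1..n-1}. cocoercive \<beta> (B i)"
    and "pair_digraph G" and "pverts G = {1..n}"
    and "Digraph_Component.connected (with_proj G)"
    and "\<forall>i j. (i, j) \<in> parcs G \<longrightarrow> i < j"
    and "\<forall>i\<in>{2..n}. h i \<in> {1..n-1} \<and> (h i, i) \<in> parcs G"
  shows
    "(subgraph (with_proj (spanning_graph n (inward_star n))) (with_proj G) \<longrightarrow>
       (\<forall>\<theta>>0. \<exists>L. fixed_point_relocators (tuples (n-1)) (l2_dist (n-1)) {0<..}
          (\<lambda>\<gamma>. T_op n G (inward_star n) h A B \<theta> \<gamma>)
          (\<lambda>\<delta> \<gamma>. Q_inward n G h A B \<delta> \<gamma>) L) \<and>
       (\<forall>\<delta>>0. \<forall>\<gamma>>0. \<forall>z\<in>tuples (n-1).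
          x_map n G (inward_star n) h A B \<gamma> z 1
            = x_map n G (inward_star n) h A B \<delta> (Q_inward n G h A B \<delta> \<gamma> z) 1))
     \<and>
     (subgraph (with_proj (spanning_graph n outward_star)) (with_proj G) \<longrightarrow>
       (\<forall>\<theta>>0. \<exists>L. fixed_point_relocators (tuples (n-1)) (l2_dist (n-1)) {0<..}
          (\<lambda>\<gamma>. T_op n G outward_star h A B \<theta> \<gamma>)
          (\<lambda>\<delta> \<gamma>. Q_outward n G h A B \<delta> \<gamma>) L) \<and>
       (\<forall>\<delta>>0. \<forall>\<gamma>>0. \<forall>z\<in>tuples (n-1).
          x_map n G outward_star h A B \<gamma> z 1
            = x_map n G outward_star h A B \<delta> (Q_outward n G h A B \<delta> \<gamma> z) 1))
     \<and>
     (subgraph (with_proj (spanning_graph n sequential_path)) (with_proj G) \<longrightarrow>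
       (\<forall>\<theta>>0. \<exists>L. fixed_point_relocators (tuples (n-1)) (l2_dist (n-1)) {0<..}
          (\<lambda>\<gamma>. T_op n G sequential_path h A B \<theta> \<gamma>)
          (\<lambda>\<delta> \<gamma>. Q_sequential n G h A B \<delta> \<gamma>) L) \<and>
       (\<forall>\<delta>>0. \<forall>\<gamma>>0. \<forall>z\<in>tuples (n-1).
          x_map n G sequential_path h A B \<gamma> z 1
            = x_map n G sequential_path h A B \<delta> (Q_sequential n G h A B \<delta> \<gamma> z) 1))"
proof -
  interpret pair_digraph G by fact
  have gap_sum: "(\<Sum>j=1..n-1. degree_gap G j) = - degree_gap G n"
    "(\<Sum>j=1..n-1. degree_gap G (j + 1)) = - degree_gap G 1"
  proof -
    have "(\<Sum>j=1..n. degree_gap G j) = 0"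
      using sum_degree_gap[OF pair_fin_digraph_axioms] \<open>pverts G = {1..n}\<close> by simp
    moreover have "(\<Sum>j=1..n. degree_gap G j) = (\<Sum>j=1..n-1. degree_gap G j) + degree_gap G n"
      using \<open>n \<ge> 2\<close> by (cases n) auto
    moreover have "(\<Sum>j=1..n. degree_gap G j) = degree_gap G 1 + (\<Sum>j=1..n-1. degree_gap G (j + 1))"
      using \<open>n \<ge> 2\<close> sum.shift_bounds_cl_nat_ivl[of "degree_gap G" 1 1 "n - 1"]
      by (simp add: sum.atLeast_Suc_atMost numeral_2_eq_2)
    ultimately show "(\<Sum>j=1..n-1. degree_gap G j) = - degree_gap G n"
      "(\<Sum>j=1..n-1. degree_gap G (j + 1)) = - degree_gap G 1" by auto
  qed
  have delta: "(\<Sum>j=1..n-1. (if j = i then 1 else 0) * f j) = (if i \<in> {1..n-1} then f i else 0)"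
    for i and f :: "nat \<Rightarrow> real"
    by (simp add: if_distrib[of "\<lambda>r. r * _"] sum.delta cong: if_cong)

  interpret inward: spanning_relocation G n A B h "inward_star n" "degree_gap G"
  proof
    fix i assume i: "i \<in> {1..n}"
    show "(\<Sum>j=1..n-1. Inc (inward_star n) i j * degree_gap G j) = degree_gap G i"
    proof (cases "i = n")
      case True
      \<comment> \<open>Every arc enters the centre \<open>n\<close>, so its row is constantly -1
        and the vanishing total gap supplies the value.\<close>
      have "(\<Sum>j=1..n-1. Inc (inward_star n) i j * degree_gap G j) = (\<Sum>j=1..n-1. - degree_gap G j)"
        using True by (intro sum.cong) (auto simp: Inc_def inward_star_def)
      with gap_sum True show ?thesis by (simp add: sum_negf)
    next
      case False
      then have "Inc (inward_star n) i j = (if j = i then 1 else 0)" for j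
        by (auto simp: Inc_def inward_star_def)
      with False i show ?thesis by (simp only: delta) auto
    qed
  next
    fix x :: "nat \<Rightarrow> 'a" and i
    assume "\<And>j. j \<in> {1..n-1} \<Longrightarrow> (\<Sum>i=1..n. Inc (inward_star n) i j *\<^sub>R x i) = 0"
    \<comment> \<open>All components are compared through the centre \<open>n\<close>.\<close>
    then have *: "x j = x n" if "j \<in> {1..n-1}" for j
      using that sum_Inc_column[of "inward_star n" j j n n x] by (fastforce simp: inward_star_def)
    assume "i \<in> {1..n}"
    then show "x i = x 1"
      using *[of 1] *[of i] \<open>n \<ge> 2\<close> by (cases "i = n") auto
  qed (use assms in auto)

  interpret outward: spanning_relocation G n A B h outward_star "\<lambda>i. - degree_gap G (i + 1)"
  proof
    fix i assume i: "i \<in> {1..n}"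
    show "(\<Sum>j=1..n-1. Inc outward_star i j * - degree_gap G (j + 1)) = degree_gap G i"
    proof (cases "i = 1")
      case True
      have "(\<Sum>j=1..n-1. Inc outward_star i j * - degree_gap G (j + 1))
          = (\<Sum>j=1..n-1. - degree_gap G (j + 1))"
        using True by (intro sum.cong) (auto simp: Inc_def outward_star_def)
      with gap_sum True show ?thesis by (simp add: sum_negf)
    next
      case False
      \<comment> \<open>Arc \<open>j\<close> enters node \<open>j + 1\<close>, so row
        \<open>i\<close> selects \<open>j = i - 1\<close>; its entry -1 cancels the sign in the
        coefficient.\<close>
      with i have "Inc outward_star i j * - degree_gap G (j + 1)
          = (if j = i - 1 then 1 else 0) * degree_gap G (j + 1)" for j
        by (auto simp: Inc_def outward_star_def)
      with False i show ?thesis by (simp only: delta) auto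
    qed
  next
    fix x :: "nat \<Rightarrow> 'a" and i
    assume *: "\<And>j. j \<in> {1..n-1} \<Longrightarrow> (\<Sum>i=1..n. Inc outward_star i j *\<^sub>R x i) = 0"
    assume i: "i \<in> {1..n}"
    show "x i = x 1"
    proof (cases "i = 1")
      case False
      with i have "i - 1 \<in> {1..n-1}" by auto
      with i *[of "i - 1"] sum_Inc_column[of outward_star "i - 1" 1 i n x] False show ?thesis
        by (simp add: outward_star_def)
    qed simp
  qed (use assms in auto)

  interpret sequential: spanning_relocation G n A B h sequential_path "\<lambda>i. \<Sum>j=1..i. degree_gap G j"
  proof
    fix i assume i: "i \<in> {1..n}"
    let ?c = "\<lambda>i. \<Sum>j=1..i. degree_gap G j"
    \<comment> \<open>Node \<open>i\<close> is left by arc \<open>i\<close> and entered by arc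
      \<open>i - 1\<close>, so the row takes a difference of consecutive partial sums.\<close>
    have "Inc sequential_path i j * ?c j
        = (if j = i then 1 else 0) * ?c j - (if j = i - 1 then 1 else 0) * ?c j" for j
      using i by (auto simp: Inc_def sequential_path_def)
    then have "(\<Sum>j=1..n-1. Inc sequential_path i j * ?c j)
        = (if i \<in> {1..n-1} then ?c i else 0) - (if i - 1 \<in> {1..n-1} then ?c (i - 1) else 0)"
      by (simp only: sum_subtractf delta)
    \<comment> \<open>At \<open>i = 1\<close> the missing arc 0 is harmless because
      \<open>?c 0\<close> is an empty sum. At \<open>i = n\<close> there is no outgoing arc, and
      \<open>gap_sum\<close> turns \<open>- ?c (n - 1)\<close> into the last gap.\<close>
    also have "\<dots> = (if i = n then 0 else ?c i) - ?c (i - 1)"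
      using i by auto
    also have "\<dots> = degree_gap G i"
      using i gap_sum(1) by (cases i) auto
    finally show "(\<Sum>j=1..n-1. Inc sequential_path i j * ?c j) = degree_gap G i" .
  next
    fix x :: "nat \<Rightarrow> 'a" and i
    assume *: "\<And>j. j \<in> {1..n-1} \<Longrightarrow> (\<Sum>i=1..n. Inc sequential_path i j *\<^sub>R x i) = 0"
    assume "i \<in> {1..n}"
    then have "1 \<le> i" "i \<le> n" by auto
    then show "x i = x 1"
    proof (induction i rule: dec_induct)
      case (step k)
      then show ?case
        using *[of k] sum_Inc_column[of sequential_path k k "k + 1" n x]
        by (auto simp: sequential_path_def)
    qed simp
  qed (use assms in auto)

  have Q: "Q_inward n G h A B = inward.Q" "Q_outward n G h A B = outward.Q"
    "Q_sequential n G h A B = sequential.Q"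
    by (intro ext, simp only: Q_inward_def inward.Q_def Q_outward_def outward.Q_def
        Q_sequential_def sequential.Q_def mult_minus_right scaleR_minus_left diff_conv_add_uminus)+
  show ?thesis
    unfolding Q using inward.Q_relocators inward.x_1_Q outward.Q_relocators outward.x_1_Q
      sequential.Q_relocators sequential.x_1_Q by (simp del: One_nat_def)
qed

end
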